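(* Let the diamond graph be the graph on vertices $d_1,d_2,d_3,d_4$ with edges $d_1d_2$, $d_1d_3$, $d_2d_3$, $d_2d_4$, $d_3d_4$ (i.e. $K_4$ minus the edge $d_1d_4$). Let $H$ be the $(d_1,1)$-ordering of the diamond graph. Then $R_<(H)\le 14$.
   Context: A $k$-ordering of a graph $H$ assigns distinct order-labels from $\{1,\ldots,|H|\}$ to $k$ of the vertices of $H$. For a vertex $v$ of $H$ and $1\le l\le |H|$, the $(v,l)$-ordering of $H$ is the 1-ordering in which $v$ receives order-label $l$ and no other vertex is labeled. An ordered 2-coloring on $n$ vertices is a red/blue coloring of the edges of the complete graph on vertex set $\{1,\ldots,n\}$. It contains a $k$-ordering $H$ (in a given color) if it has a subgraph isomorphic to $H$, all of whose edges have that color, such that for every $i$ the $i$-th smallest vertex of the copy corresponds to a vertex of $H$ that has order-label $i$ or no order-label. $R_<(H)$ is the least $n$ such that every ordered 2-coloring on $n$ vertices contains a monochromatic (red or blue) copy of $H$. *)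

theory Defs
  imports "HOL-Library.Ramsey" "HOL-Library.Extended_Nat"
begin

record 'a graph =
  vertices :: "'a set"
  edges :: "'a set set"

definition simple_graph :: "'a graph \<Rightarrow> bool" where
  "simple_graph G \<longleftrightarrow> finite (vertices G) \<and> edges G \<subseteq> [vertices G]\<^bsup>2\<^esup>"

text \<open>An ordering of a graph records its order-labels as a partial map; \<open>None\<close> means unlabeled.\<close>

record 'a ordering = "'a graph" +
  order_label :: "'a \<rightharpoonup> nat"

definition k_ordering :: "nat \<Rightarrow> 'a ordering \<Rightarrow> bool" where
  "k_ordering k H \<longleftrightarrow>
     simple_graph (graph.truncate H) \<and>
     dom (order_label H) \<subseteq> vertices H \<and> card (dom (order_label H)) = k \<and>
     inj_on (order_label H) (dom (order_label H)) \<and>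
     ran (order_label H) \<subseteq> {1..card (vertices H)}"

definition vl_ordering :: "'a graph \<Rightarrow> 'a \<Rightarrow> nat \<Rightarrow> 'a ordering" where
  "vl_ordering G v l = graph.extend G (ordering.fields [v \<mapsto> l])"

datatype color = Red | Blue

text \<open>
  An ordered 2-coloring on \<open>n\<close> vertices is a function from edges to colors of which only the
  values on the edges \<open>[{1..n}]\<^bsup>2\<^esup>\<close> of the complete graph matter.
\<close>

type_synonym coloring = "nat set \<Rightarrow> color"

definition ith_smallest :: "nat set \<Rightarrow> nat \<Rightarrow> nat" where
  "ith_smallest S i = sorted_list_of_set S ! (i - 1)"

text \<open>The map \<open>f\<close> is the isomorphism from \<open>H\<close> onto its copy (a not necessarily induced subgraph).\<close>

definition contains_in_color :: "nat \<Rightarrow> coloring \<Rightarrow> color \<Rightarrow> 'a ordering \<Rightarrow> bool" where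
  "contains_in_color n \<chi> c H \<longleftrightarrow>
     (\<exists>f. inj_on f (vertices H) \<and> f ` vertices H \<subseteq> {1..n} \<and>
          (\<forall>e\<in>edges H. \<chi> (f ` e) = c) \<and>
          (\<forall>i\<in>{1..card (vertices H)}. \<forall>v\<in>vertices H.
             f v = ith_smallest (f ` vertices H) i \<longrightarrow>
             order_label H v = Some i \<or> order_label H v = None))"

definition ordered_ramsey :: "nat \<Rightarrow> 'a ordering \<Rightarrow> bool" where
  "ordered_ramsey n H \<longleftrightarrow> (\<forall>\<chi>. \<exists>c. contains_in_color n \<chi> c H)"

text \<open>The value is \<open>\<infinity>\<close> if no suitable \<open>n\<close> exists, so an upper bound also asserts existence.\<close>

definition R_less :: "'a ordering \<Rightarrow> enat" where
  "R_less H = (INF n\<in>{n. ordered_ramsey n H}. enat n)"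

lemma R_less_eq_Least:
  assumes "ordered_ramsey n H"
  shows "R_less H = enat (LEAST n. ordered_ramsey n H)"
  unfolding R_less_def
proof (rule antisym)
  show "(INF n\<in>{n. ordered_ramsey n H}. enat n) \<le> enat (LEAST n. ordered_ramsey n H)"
    by (rule INF_lower) (simp add: LeastI[of "\<lambda>n. ordered_ramsey n H", OF assms])
  show "enat (LEAST n. ordered_ramsey n H) \<le> (INF n\<in>{n. ordered_ramsey n H}. enat n)"
    by (rule INF_greatest) (simp add: Least_le)
qed

datatype diamond_vertex = d1 | d2 | d3 | d4

definition diamond :: "diamond_vertex graph" where
  "diamond = \<lparr>vertices = {d1, d2, d3, d4},
              edges = {{d1, d2}, {d1, d3}, {d2, d3}, {d2, d4}, {d3, d4}}\<rparr>"

lemma k_ordering_vl_ordering: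
  assumes "simple_graph G" "v \<in> vertices G" "1 \<le> l" "l \<le> card (vertices G)"
  shows "k_ordering 1 (vl_ordering G v l)"
  using assms
proof -
  have "simple_graph (graph.truncate (vl_ordering G v l))" "vertices (vl_ordering G v l) = vertices G"
    "order_label (vl_ordering G v l) = [v \<mapsto> l]"
    using assms(1) by (simp_all add: vl_ordering_def simple_graph_def graph.defs ordering.defs)
  then show ?thesis
    using assms by (simp add: k_ordering_def)
qed

lemma simple_graph_diamond: "simple_graph diamond"
  by (simp add: simple_graph_def diamond_def nsets_def)

end

(* Say that red is the majority color at vertex 1, and let N (|N| >= 7) and M be its red and blue
   neighbourhoods. A red edge in N lies in no red triangle avoiding 1, so the red neighbours in N of
   any vertex v > 1 form a blue clique; there are at most 3 of them, since a K4 contains every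
   1-ordering of the diamond. Hence every vertex of M has at least |N| - 3 > |N|/2 blue neighbours
   in N, so any two vertices of M have a common one and cannot be joined by a blue edge. So M is a
   red clique, |M| <= 3 and |N| >= 10. The least vertex x of N now has at least 6 blue neighbours in
   N; by R(3,3) = 6 these contain a monochromatic triangle, which is impossible: a red one is
   excluded in N, and a blue one forms a blue K4 with x. *)

theory Submission
  imports Defs
begin

lemma color_eq_if_neq: "a \<noteq> c \<Longrightarrow> b \<noteq> c \<Longrightarrow> a = (b :: color)"
  by (cases a; cases b; cases c; simp)

text \<open>Serves the label condition at \<open>d1\<close>: the sorted list of
  \<open>insert a S\<close> has \<open>a\<close> at its head, so every later entry lies in
  \<open>S\<close> and exceeds \<open>a\<close>.\<close>

lemma ith_smallest_insert_less:
  assumes "finite S" "\<And>s. s \<in> S \<Longrightarrow> a < s" "i \<in> {1..Suc (card S)}" "ith_smallest (insert a S) i = a"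
  shows "i = 1"
proof (rule ccontr)
  assume "i \<noteq> 1"
  with assms(3) obtain j where j: "i = Suc (Suc j)" "j < card S"
    by (cases i; cases "i - 1") auto
  have "sorted_list_of_set (insert a S) = a # sorted_list_of_set S"
    using assms(1,2)
    by (subst sorted_list_of_set_insert) (auto simp: insort_is_Cons order.strict_implies_order)
  then have "a \<in> set (sorted_list_of_set S)"
    using assms(1,4) j nth_mem[of j "sorted_list_of_set S"] by (auto simp: ith_smallest_def)
  with assms(1,2) show False
    by auto
qed

text \<open>Only \<open>d1\<close> is labeled, so \<open>a\<close> has to be the least vertex of the
  copy, while \<open>b\<close>, \<open>b'\<close>, \<open>d\<close> may come in any order. The
  diamond lacks the edge \<open>{d1, d4}\<close>, so the color of \<open>{a, d}\<close> is
  free.\<close>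

lemma contains_diamondI:
  assumes "{a, b, b', d} \<subseteq> {1..n}" "a < b" "a < b'" "a < d" "b \<noteq> b'" "b \<noteq> d" "b' \<noteq> d"
    and "\<chi> {a, b} = c" "\<chi> {a, b'} = c" "\<chi> {b, b'} = c" "\<chi> {b, d} = c" "\<chi> {b', d} = c"
  shows "contains_in_color n \<chi> c (vl_ordering diamond d1 1)"
proof -
  define f where "f = case_diamond_vertex a b b' d"
  have H: "vertices (vl_ordering diamond d1 1) = {d1, d2, d3, d4}"
    "edges (vl_ordering diamond d1 1) = {{d1, d2}, {d1, d3}, {d2, d3}, {d2, d4}, {d3, d4}}"
    "order_label (vl_ordering diamond d1 1) = [d1 \<mapsto> 1]"
    by (simp_all add: vl_ordering_def graph.defs ordering.defs diamond_def)
  have least: "i = 1" if "i \<in> {1..4}" "ith_smallest {a, b, b', d} i = a" for i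
    using that assms(2-7) ith_smallest_insert_less[of "{b, b', d}" a i] by auto
  show ?thesis
    unfolding contains_in_color_def H
  proof (intro exI[of _ f] conjI ballI impI)
    fix i v
    assume "i \<in> {1..card {d1, d2, d3, d4}}" "f v = ith_smallest (f ` {d1, d2, d3, d4}) i"
    then show "[d1 \<mapsto> 1] v = Some i \<or> [d1 \<mapsto> 1] v = None"
      using least[of i] by (cases v) (auto simp: f_def)
  qed (use assms in \<open>auto simp: f_def\<close>)
qed

lemma obtain_three:
  assumes "3 \<le> card S"
  obtains x y z where "x \<in> S" "y \<in> S" "z \<in> S" "x \<noteq> y" "x \<noteq> z" "y \<noteq> z"
proof -
  obtain T where "T \<subseteq> S" "card T = 3"
    using assms obtain_subset_with_card_n by metis
  then show thesis
    using that by (auto simp: card_3_iff)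
qed

text \<open>\<open>S\<close> may contain \<open>v\<close>, and \<open>\<chi>\<close> also takes a
  value on the singleton \<open>{v}\<close>; hence the condition
  \<open>w \<noteq> v\<close>.\<close>

definition nbr :: "coloring \<Rightarrow> color \<Rightarrow> nat \<Rightarrow> nat set \<Rightarrow> nat set" where
  "nbr \<chi> c v S = {w \<in> S. w \<noteq> v \<and> \<chi> {v, w} = c}"

lemma nbr_subset: "nbr \<chi> c v S \<subseteq> S"
  by (auto simp: nbr_def)

lemma card_nbr_add:
  assumes "finite S" "c \<noteq> c'"
  shows "card (nbr \<chi> c v S) + card (nbr \<chi> c' v S) = card (S - {v})"
proof -
  have "S - {v} = nbr \<chi> c v S \<union> nbr \<chi> c' v S" "nbr \<chi> c v S \<inter> nbr \<chi> c' v S = {}"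
    using assms(2) by (auto simp: nbr_def intro: color_eq_if_neq)
  with assms(1) show ?thesis
    by (metis card_Un_disjoint finite_subset nbr_subset)
qed

text \<open>The bound R(3,3) \<le> 6: of the at least five edges at a vertex, three share a
  color.\<close>

lemma monochromatic_triangle:
  fixes \<chi> :: coloring
  assumes "6 \<le> card S"
  obtains c x y z where "x \<in> S" "y \<in> S" "z \<in> S" "x \<noteq> y" "x \<noteq> z" "y \<noteq> z"
    "\<chi> {x, y} = c" "\<chi> {x, z} = c" "\<chi> {y, z} = c"
proof -
  obtain v where v: "v \<in> S" and fin: "finite S"
    using assms by (metis card.empty card.infinite equals0I not_numeral_le_zero)
  have "card (nbr \<chi> Red v S) + card (nbr \<chi> Blue v S) \<ge> 5"
    using card_nbr_add[of S Red Blue \<chi> v] fin v assms by simp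
  then have "3 \<le> card (nbr \<chi> Red v S) \<or> 3 \<le> card (nbr \<chi> Blue v S)"
    by linarith
  then obtain c where "3 \<le> card (nbr \<chi> c v S)"
    by blast
  then obtain x y z where xyz: "x \<in> nbr \<chi> c v S" "y \<in> nbr \<chi> c v S" "z \<in> nbr \<chi> c v S"
    "x \<noteq> y" "x \<noteq> z" "y \<noteq> z"
    by (rule obtain_three)
  \<comment> \<open>An edge of color \<open>c\<close> among \<open>x\<close>, \<open>y\<close>,
    \<open>z\<close> closes a triangle with \<open>v\<close>; if there is none, all three edges have
    the other color.\<close>
  consider "\<chi> {x, y} = c" | "\<chi> {x, z} = c" | "\<chi> {y, z} = c"
    | "\<chi> {x, y} = \<chi> {x, z}" "\<chi> {x, z} = \<chi> {y, z}"
    by (metis color_eq_if_neq)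
  then show thesis
    using xyz v by cases (auto simp: nbr_def intro: that[of v x y c] that[of v x z c]
        that[of v y z c] that[of x y z "\<chi> {x, y}"])
qed

text \<open>The setting of a counterexample. As \<open>c\<close> ranges over both colors, the lemmas
  below may be used with the colors exchanged.\<close>

locale ordered_diamond_free =
  fixes n :: nat and \<chi> :: coloring
  assumes diamond_free: "\<not> contains_in_color n \<chi> c (vl_ordering diamond d1 1)"
begin

text \<open>In a larger clique the least vertex serves as \<open>d1\<close> and any three others as
  \<open>d2\<close>, \<open>d3\<close>, \<open>d4\<close>.\<close>

lemma clique_card_le:
  assumes "S \<subseteq> {1..n}" "\<And>u v. u \<in> S \<Longrightarrow> v \<in> S \<Longrightarrow> u \<noteq> v \<Longrightarrow> \<chi> {u, v} = c"
  shows "card S \<le> 3"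
proof (rule ccontr)
  assume "\<not> card S \<le> 3"
  then have "finite S" "S \<noteq> {}" "3 \<le> card (S - {Min S})"
    by (auto simp: card_ge_0_finite card_Diff_singleton_if)
  moreover obtain b b' d where "b \<in> S - {Min S}" "b' \<in> S - {Min S}" "d \<in> S - {Min S}"
    "b \<noteq> b'" "b \<noteq> d" "b' \<noteq> d"
    using \<open>3 \<le> _\<close> by (rule obtain_three)
  moreover have "Min S < x" if "x \<in> S - {Min S}" for x
    using that \<open>finite S\<close> by (simp add: order.strict_iff_order)
  moreover have "Min S \<in> S" "Min S \<in> {1..n}"
    using \<open>finite S\<close> \<open>S \<noteq> {}\<close> assms(1) Min_in by blast+
  ultimately have "contains_in_color n \<chi> c (vl_ordering diamond d1 1)"
    using assms by (intro contains_diamondI[of "Min S" b b' d]) auto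
  with diamond_free show False ..
qed

text \<open>Otherwise there is a diamond with 1 as \<open>d1\<close>, \<open>x\<close> and
  \<open>y\<close> as \<open>d2\<close> and \<open>d3\<close>, and \<open>v\<close> as
  \<open>d4\<close>. The edge \<open>{1, v}\<close> is not part of it, so \<open>v\<close> may lie
  in either neighbourhood of 1.\<close>

lemma common_nbr_neq:
  assumes "1 < v" "v \<le> n" "x \<in> nbr \<chi> c 1 {2..n}" "y \<in> nbr \<chi> c 1 {2..n}" "x \<noteq> y"
    "v \<noteq> x" "v \<noteq> y" "\<chi> {v, x} = c" "\<chi> {v, y} = c"
  shows "\<chi> {x, y} \<noteq> c"
  using contains_diamondI[of 1 x y v n \<chi> c] diamond_free[of c] assms
  by (auto simp: nbr_def insert_commute)

lemma card_nbr_nbr_le: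
  assumes "v \<in> {2..n}"
  shows "card (nbr \<chi> c v (nbr \<chi> c 1 {2..n})) \<le> 3"
proof -
  obtain c' where "c' \<noteq> c"
    by (metis color.distinct(1))
  show ?thesis
  proof (rule clique_card_le)
    fix x y
    assume "x \<in> nbr \<chi> c v (nbr \<chi> c 1 {2..n})" "y \<in> nbr \<chi> c v (nbr \<chi> c 1 {2..n})" "x \<noteq> y"
    with assms have "\<chi> {x, y} \<noteq> c"
      by (intro common_nbr_neq[of v]) (auto simp: nbr_def)
    with \<open>c' \<noteq> c\<close> show "\<chi> {x, y} = c'"
      by (rule color_eq_if_neq[rotated])
  qed (auto simp: nbr_def)
qed

lemma card_other_nbr_le:
  assumes "c \<noteq> c'" "7 \<le> card (nbr \<chi> c 1 {2..n})"
  shows "card (nbr \<chi> c' 1 {2..n}) \<le> 3"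
proof (rule clique_card_le)
  let ?N = "nbr \<chi> c 1 {2..n}"
  fix u v
  assume uv: "u \<in> nbr \<chi> c' 1 {2..n}" "v \<in> nbr \<chi> c' 1 {2..n}" "u \<noteq> v"
  have fin: "finite ?N"
    by (auto simp: nbr_def)
  have large: "card ?N \<le> card (nbr \<chi> c' w ?N) + 3" if "w \<in> nbr \<chi> c' 1 {2..n}" for w
  proof -
    have "?N - {w} = ?N" "w \<in> {2..n}"
      using that assms(1) by (auto simp: nbr_def)
    with card_nbr_nbr_le[of w c] card_nbr_add[OF fin assms(1), of \<chi> w] show ?thesis
      by simp
  qed
  \<comment> \<open>Both sets miss at most 3 elements of \<open>?N\<close>, and 3 + 3 < 7.\<close>
  have "nbr \<chi> c' u ?N \<inter> nbr \<chi> c' v ?N \<noteq> {}"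
  proof
    assume "nbr \<chi> c' u ?N \<inter> nbr \<chi> c' v ?N = {}"
    then have "card (nbr \<chi> c' u ?N) + card (nbr \<chi> c' v ?N) \<le> card ?N"
      using fin by (metis Un_least card_Un_disjoint card_mono finite_subset nbr_subset)
    with large[OF uv(1)] large[OF uv(2)] assms(2) show False
      by linarith
  qed
  then obtain w where "w \<in> nbr \<chi> c' u ?N" "w \<in> nbr \<chi> c' v ?N"
    by blast
  \<comment> \<open>Now the diamond would have color \<open>c'\<close>, with \<open>w\<close> as
    \<open>d4\<close> although \<open>{1, w}\<close> has color \<open>c\<close>.\<close>
  with uv have "\<chi> {u, v} \<noteq> c'"
    by (intro common_nbr_neq[of w]) (auto simp: nbr_def insert_commute)
  with assms(1) show "\<chi> {u, v} = c"
    by (rule color_eq_if_neq[rotated])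
qed (auto simp: nbr_def)

lemma card_nbr_1_less:
  assumes "c \<noteq> c'"
  shows "card (nbr \<chi> c 1 {2..n}) < 10"
proof (rule ccontr)
  let ?N = "nbr \<chi> c 1 {2..n}"
  define x where "x = Min ?N"
  let ?B = "nbr \<chi> c' x ?N"
  assume "\<not> card ?N < 10"
  then have N: "10 \<le> card ?N"
    by simp
  then have fin: "finite ?N" and "?N \<noteq> {}"
    by (intro card_ge_0_finite, linarith) (use N in force)
  then have x: "x \<in> ?N"
    unfolding x_def by (intro Min_in)
  then have "x \<in> {2..n}"
    by (simp add: nbr_def)
  \<comment> \<open>Of the at least 9 other vertices of \<open>?N\<close>, at most 3 are joined to
    \<open>x\<close> in color \<open>c\<close>.\<close>
  then have "6 \<le> card ?B"
    using N x fin card_nbr_nbr_le[of x c] card_nbr_add[OF fin assms, of \<chi> x] by simp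
  then obtain c'' p q r where pqr: "p \<in> ?B" "q \<in> ?B" "r \<in> ?B" "p \<noteq> q" "p \<noteq> r" "q \<noteq> r"
    and col: "\<chi> {p, q} = c''" "\<chi> {p, r} = c''" "\<chi> {q, r} = c''"
    by (rule monochromatic_triangle)
  show False
  proof (cases "c'' = c")
    case True
    \<comment> \<open>Here \<open>r\<close>, itself in \<open>?N\<close>, plays the part of
      \<open>d4\<close>.\<close>
    with pqr col common_nbr_neq[of p q c r] show False
      by (auto simp: nbr_def)
  next
    case False
    then have "c'' = c'"
      using assms color_eq_if_neq by blast
    then have "card {x, p, q, r} \<le> 3"
      using pqr col x by (intro clique_card_le[of _ c']) (auto simp: nbr_def insert_commute)
    with pqr show False
      by (auto simp: nbr_def)
  qed
qed

lemma less_14: "n < 14"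
proof (rule ccontr)
  assume "\<not> n < 14"
  \<comment> \<open>Vertex 1 would have at most 9 neighbours in color \<open>c\<close> and 3 in
    color \<open>c'\<close>, but there are at least 13 other vertices.\<close>
  have *: False if "c \<noteq> c'" "7 \<le> card (nbr \<chi> c 1 {2..n})" for c c'
    using card_other_nbr_le[OF that] card_nbr_1_less[OF that(1)] \<open>\<not> n < 14\<close>
      card_nbr_add[OF _ that(1), of "{2..n}" \<chi> 1] by simp
  have "13 \<le> card (nbr \<chi> Red 1 {2..n}) + card (nbr \<chi> Blue 1 {2..n})"
    using card_nbr_add[of "{2..n}" Red Blue \<chi> 1] \<open>\<not> n < 14\<close> by simp
  then consider "7 \<le> card (nbr \<chi> Red 1 {2..n})" | "7 \<le> card (nbr \<chi> Blue 1 {2..n})"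
    by linarith
  then show False
    using *[of Red Blue] *[of Blue Red] by cases auto
qed

end

theorem theorem3p7:
  shows "R_less (vl_ordering diamond d1 1) \<le> 14"
proof -
  have "ordered_ramsey 14 (vl_ordering diamond d1 1)"
    unfolding ordered_ramsey_def
    using ordered_diamond_free.less_14[of 14, OF ordered_diamond_free.intro] by blast
  then have "R_less (vl_ordering diamond d1 1) \<le> enat 14"
    unfolding R_less_def by (intro INF_lower) simp
  then show ?thesis
    by (simp add: numeral_eq_enat)
qed

end
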